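(* Let $\lambda$ be a nonzero real number. For every integer $n\ge 0$ and every real $x$, $$H_{n,\lambda}(x)=e^{-x}\sum_{k=0}^{\infty}\frac{\langle k\rangle_{n,\lambda}}{k!}x^{k}.$$
   Context: For $\lambda\in\mathbb{R}$, $\lambda\neq 0$: $\langle x\rangle_{0,\lambda}=1$, $\langle x\rangle_{n,\lambda}=x(x+\lambda)\cdots(x+(n-1)\lambda)$ for $n\ge 1$. The falling factorial is $(x)_0=1$, $(x)_n=x(x-1)\cdots(x-n+1)$ for $n\ge 1$. The heterogeneous Stirling numbers of the second kind $H_\lambda(n,k)$ are defined by the polynomial identity $\langle x\rangle_{n,\lambda}=\sum_{k=0}^{n}H_{\lambda}(n,k)(x)_{k}$ for $n\ge 0$, with $H_\lambda(n,k)=0$ for $k<0$ or $n<k$. The heterogeneous Bell polynomials are $H_{n,\lambda}(x)=\sum_{k=0}^{n}H_{\lambda}(n,k)x^{k}$, $n\ge 0$. *)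

theory Defs
  imports Complex_Main
begin

definition rising_lam :: "real \<Rightarrow> real \<Rightarrow> nat \<Rightarrow> real" where
  "rising_lam lam x n = (\<Prod>i<n. x + real i * lam)"

definition falling :: "real \<Rightarrow> nat \<Rightarrow> real" where
  "falling x n = (\<Prod>i<n. x - real i)"

definition is_het_stirling2 :: "real \<Rightarrow> (nat \<Rightarrow> nat \<Rightarrow> real) \<Rightarrow> bool" where
  "is_het_stirling2 lam S \<longleftrightarrow>
     (\<forall>n x. rising_lam lam x n = (\<Sum>k\<le>n. S n k * falling x k)) \<and>
     (\<forall>n k. n < k \<longrightarrow> S n k = 0)"

text \<open>
  The heterogeneous Stirling numbers are the coefficients determined by the identity above;
  existence and uniqueness are proved below. The lower index ranges over the naturals, so the
  convention that the numbers vanish for negative lower index has no counterpart.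
\<close>

definition het_stirling2 :: "real \<Rightarrow> nat \<Rightarrow> nat \<Rightarrow> real" where
  "het_stirling2 lam = (THE S. is_het_stirling2 lam S)"

definition het_bell :: "real \<Rightarrow> nat \<Rightarrow> real \<Rightarrow> real" where
  "het_bell lam n x = (\<Sum>k\<le>n. het_stirling2 lam n k * x ^ k)"

lemma falling_Suc: "falling x (Suc k) = falling x k * (x - real k)"
  by (simp add: falling_def)

lemma falling_of_nat_eq_0: "m < k \<Longrightarrow> falling (real m) k = 0"
  by (auto simp: falling_def)

lemma falling_of_nat_self_neq_0: "falling (real m) m \<noteq> 0"
  by (auto simp: falling_def)

lemma falling_coeffs_unique:
  fixes c d :: "nat \<Rightarrow> real"
  assumes eq: "\<And>x. (\<Sum>k\<le>n. c k * falling x k) = (\<Sum>k\<le>n. d k * falling x k)"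
    and "m \<le> n"
  shows "c m = d m"
  using \<open>m \<le> n\<close>
proof (induction m rule: less_induct)
  case (less m)
  have split: "(\<Sum>k\<le>n. f k * falling (real m) k)
      = (\<Sum>k<m. f k * falling (real m) k) + f m * falling (real m) m" for f :: "nat \<Rightarrow> real"
  proof -
    have "(\<Sum>k\<le>n. f k * falling (real m) k) = (\<Sum>k\<le>m. f k * falling (real m) k)"
      using less.prems by (intro sum.mono_neutral_right) (auto simp: falling_of_nat_eq_0)
    then show ?thesis by (simp add: lessThan_Suc_atMost [symmetric])
  qed
  have "(\<Sum>k<m. c k * falling (real m) k) = (\<Sum>k<m. d k * falling (real m) k)"
    using less by (intro sum.cong) auto
  then show ?case
    using eq [of "real m"] falling_of_nat_self_neq_0 [of m] by (simp add: split)
qed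

fun het_stirling2_rec :: "real \<Rightarrow> nat \<Rightarrow> nat \<Rightarrow> real" where
  "het_stirling2_rec lam 0 k = (if k = 0 then 1 else 0)"
| "het_stirling2_rec lam (Suc n) k =
     (if k = 0 then 0 else het_stirling2_rec lam n (k - 1))
     + (real n * lam + real k) * het_stirling2_rec lam n k"

lemma het_stirling2_rec_eq_0: "n < k \<Longrightarrow> het_stirling2_rec lam n k = 0"
  by (induction n arbitrary: k) auto

lemma is_het_stirling2_rec: "is_het_stirling2 lam (het_stirling2_rec lam)"
proof -
  let ?S = "het_stirling2_rec lam"
  have "rising_lam lam x n = (\<Sum>k\<le>n. ?S n k * falling x k)" for n x
  proof (induction n)
    case 0
    then show ?case by (simp add: rising_lam_def falling_def)
  next
    case (Suc n)
    have "(\<Sum>k\<le>Suc n. ?S (Suc n) k * falling x k)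
        = (\<Sum>k\<le>Suc n. (if k = 0 then 0 else ?S n (k - 1)) * falling x k)
          + (\<Sum>k\<le>Suc n. (real n * lam + real k) * ?S n k * falling x k)"
      by (simp only: het_stirling2_rec.simps distrib_right sum.distrib)
    also have "(\<Sum>k\<le>Suc n. (if k = 0 then 0 else ?S n (k - 1)) * falling x k)
        = (\<Sum>k\<le>n. ?S n k * falling x (Suc k))"
      by (simp only: sum.atMost_Suc_shift) simp
    also have "(\<Sum>k\<le>Suc n. (real n * lam + real k) * ?S n k * falling x k)
        = (\<Sum>k\<le>n. (real n * lam + real k) * ?S n k * falling x k)"
      by (simp add: het_stirling2_rec_eq_0)
    also have "(\<Sum>k\<le>n. ?S n k * falling x (Suc k))
          + (\<Sum>k\<le>n. (real n * lam + real k) * ?S n k * falling x k)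
        = (\<Sum>k\<le>n. ?S n k * falling x k) * (x + real n * lam)"
      unfolding sum.distrib [symmetric] sum_distrib_right
      by (intro sum.cong) (simp_all add: falling_Suc algebra_simps)
    finally show ?case using Suc by (simp add: rising_lam_def)
  qed
  then show ?thesis by (simp add: is_het_stirling2_def het_stirling2_rec_eq_0)
qed

lemma ex1_het_stirling2: "\<exists>!S. is_het_stirling2 lam S"
proof (rule ex_ex1I)
  show "\<exists>S. is_het_stirling2 lam S" using is_het_stirling2_rec by blast
next
  fix S T assume S: "is_het_stirling2 lam S" and T: "is_het_stirling2 lam T"
  have "S n k = T n k" for n k
  proof (cases "k \<le> n")
    case True
    show ?thesis
      by (rule falling_coeffs_unique [OF _ True]) (use S T in \<open>metis is_het_stirling2_def\<close>)
  next
    case False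
    then show ?thesis using S T by (simp add: is_het_stirling2_def)
  qed
  then show "S = T" by blast
qed

lemma is_het_stirling2: "is_het_stirling2 lam (het_stirling2 lam)"
  unfolding het_stirling2_def by (rule theI' [OF ex1_het_stirling2])

end

theory Submission
  imports Defs
begin

text \<open>
  Dobinski's formula holds first for falling factorials: since $(m)_k / m! = 1 / (m - k)!$ for
  $m \geq k$ and $(m)_k = 0$ for $m < k$, the series $\sum_m (m)_k x^m / m!$ is the exponential
  series shifted by $k$, with sum $x^k e^x$. The general case follows by linearity from the
  expansion of the rising factorial in the falling factorial basis.
\<close>

text \<open>The last factor of \<open>falling (real (m + Suc k)) (Suc k)\<close> is m + 1, which
  turns \<open>fact m\<close> into \<open>fact (Suc m)\<close>; hence m varies in the
  induction.\<close>

lemma falling_add_mult_fact: "falling (real (m + k)) k * fact m = fact (m + k)"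
proof (induction k arbitrary: m)
  case 0
  then show ?case by (simp add: falling_def)
next
  case (Suc k)
  have "falling (real (m + Suc k)) (Suc k) * fact m
      = falling (real (Suc m + k)) k * fact (Suc m)"
    by (simp add: falling_Suc algebra_simps)
  then show ?case using Suc [of "Suc m"] by simp
qed

lemma falling_exp_sums:
  fixes x :: real
  shows "(\<lambda>m. falling (real m) k / fact m * x ^ m) sums (x ^ k * exp x)"
proof -
  let ?f = "\<lambda>m. falling (real m) k / fact m * x ^ m"
  have shift: "?f (m + k) = x ^ k * (x ^ m /\<^sub>R fact m)" for m
    \<comment> \<open>The falling factorial cancels: it is nonzero because its product with
      \<open>fact m\<close> is a factorial.\<close>
    unfolding falling_add_mult_fact [of m k, symmetric]
    using falling_add_mult_fact [of m k]
    by (auto simp: power_add divide_simps)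
  have "(\<lambda>m. ?f (m + k)) sums (x ^ k * exp x)"
    unfolding shift by (intro sums_mult exp_converges)
  then show ?thesis
    \<comment> \<open>The k terms dropped by the shift all vanish, so the sum is unchanged.\<close>
    by (subst sums_iff_shift' [of ?f k, symmetric]) (simp add: falling_of_nat_eq_0)
qed

theorem theorem2p15:
  fixes lam x :: real and n :: nat
  assumes "lam \<noteq> 0"
  shows "summable (\<lambda>k. rising_lam lam (real k) n / fact k * x ^ k) \<and>
    het_bell lam n x = exp (- x) * (\<Sum>k. rising_lam lam (real k) n / fact k * x ^ k)"
proof -
  let ?H = "het_stirling2 lam n"
  have expand: "rising_lam lam (real m) n / fact m * x ^ m
      = (\<Sum>k\<le>n. ?H k * (falling (real m) k / fact m * x ^ m))" for m
    using is_het_stirling2 [of lam]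
    by (simp add: is_het_stirling2_def sum_distrib_right sum_divide_distrib mult.assoc)
  \<comment> \<open>Only finitely many convergent series are added, so \<open>sums\<close> yields
    summability together with the value.\<close>
  have "(\<lambda>m. rising_lam lam (real m) n / fact m * x ^ m) sums (\<Sum>k\<le>n. ?H k * (x ^ k * exp x))"
    unfolding expand by (intro sums_sum sums_mult falling_exp_sums)
  also have "(\<Sum>k\<le>n. ?H k * (x ^ k * exp x)) = exp x * het_bell lam n x"
    by (simp add: het_bell_def sum_distrib_left mult_ac)
  finally show ?thesis
    by (simp add: sums_iff exp_minus)
qed

end
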